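(* Let $B\subseteq\mathbb{N}$ be a non-empty set with $\mathfrak{b}^\ast(B)=0$ (i.e., $B$ has Buck density $\mathfrak{b}(B)=0$). Then for each $\alpha\in[0,1]$ there exists $A\subseteq\mathbb{N}$ such that, for every arithmetic quasi-density $\mu$, both $A$ and $A+B$ belong to $\mathrm{dom}(\mu)$ and $\mu(A+B)=\alpha$.
   Context: $\mathbb{N}=\{0,1,2,\ldots\}$, $\mathbb{N}^+$ the positive integers. For $X\subseteq\mathbb{N}$, $k\in\mathbb{N}^+$, $h\in\mathbb{N}$, write $k\cdot X+h:=\{kx+h: x\in X\}$; the sumset of $X,Y\subseteq\mathbb{N}$ is $X+Y:=\{x+y:x\in X,\ y\in Y\}$. An arithmetic upper quasi-density is a function $\mu^\ast:\mathcal{P}(\mathbb{N})\to\mathbb{R}$ such that for all $X,Y\subseteq\mathbb{N}$: (1) $\mu^\ast(X)\le\mu^\ast(\mathbb{N})=1$; (2) $\mu^\ast(X\cup Y)\le\mu^\ast(X)+\mu^\ast(Y)$; (3) $\mu^\ast(k\cdot X+h)=\frac1k\mu^\ast(X)$ for all $k\in\mathbb{N}^+$, $h\in\mathbb{N}$. (Monotonicity is not required.) Its conjugate is $\mu_\ast(X):=1-\mu^\ast(\mathbb{N}\setminus X)$. The arithmetic quasi-density induced by $\mu^\ast$ is the restriction $\mu$ of $\mu^\ast$ to $\mathrm{dom}(\mu):=\{X\subseteq\mathbb{N}:\mu^\ast(X)=\mu_\ast(X)\}$; an arithmetic quasi-density is any function arising this way. The upper asymptotic density is $\mathsf{d}^\ast(X):=\limsup_{n\to\infty}\frac1n|X\cap[1,n]|$.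 Let $\mathscr{A}$ be the family of finite unions of arithmetic progressions $k\cdot\mathbb{N}+h$ ($k\in\mathbb{N}^+$, $h\in\mathbb{N}$). The upper Buck density is $\mathfrak{b}^\ast(X):=\inf\{\mathsf{d}^\ast(C): C\in\mathscr{A},\ X\subseteq C\}$, and $\mathfrak{b}$ denotes the density induced by $\mathfrak{b}^\ast$ (so $\mathfrak{b}(B)=0$ means $B\in\mathrm{dom}(\mathfrak{b})$ with value $0$, equivalently $\mathfrak{b}^\ast(B)=0$). *)

theory Defs
  imports "HOL-Analysis.Analysis" "HOL-Library.Set_Algebras"
begin

definition arithmetic_upper_quasi_density :: "(nat set \<Rightarrow> real) \<Rightarrow> bool" where
  "arithmetic_upper_quasi_density m \<longleftrightarrow>
     (\<forall>X. m X \<le> m UNIV) \<and> m UNIV = 1 \<and>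
     (\<forall>X Y. m (X \<union> Y) \<le> m X + m Y) \<and>
     (\<forall>X (k::nat) h. k \<ge> 1 \<longrightarrow> m ((\<lambda>x. k * x + h) ` X) = 1 / real k * m X)"

definition conjugate_density :: "(nat set \<Rightarrow> real) \<Rightarrow> nat set \<Rightarrow> real" where
  "conjugate_density m X = 1 - m (UNIV - X)"

text \<open>The restriction of \<open>m\<close> to the sets on which it agrees with its conjugate is a partial
  function, encoded as a map; its domain is then literally the library's \<^const>\<open>dom\<close>.\<close>

definition induced_density :: "(nat set \<Rightarrow> real) \<Rightarrow> (nat set \<rightharpoonup> real)" where
  "induced_density m = (\<lambda>X. if m X = conjugate_density m X then Some (m X) else None)"

definition arithmetic_quasi_density :: "(nat set \<rightharpoonup> real) \<Rightarrow> bool" where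
  "arithmetic_quasi_density \<mu> \<longleftrightarrow>
     (\<exists>m. arithmetic_upper_quasi_density m \<and> \<mu> = induced_density m)"

text \<open>The limit superior is taken in the extended reals, a complete lattice; all terms lie
  in \<open>[0,1]\<close>, so converting the value back to a real number loses nothing.\<close>

definition upper_asymptotic_density :: "nat set \<Rightarrow> real" where
  "upper_asymptotic_density X =
     real_of_ereal (limsup (\<lambda>n. ereal (real (card (X \<inter> {1..n})) / real n)))"

definition arithmetic_progressions :: "nat set set" where
  "arithmetic_progressions = {range (\<lambda>x. k * x + h) | k h. k \<ge> 1}"

definition finite_unions_of_progressions :: "nat set set" where
  "finite_unions_of_progressions =
     {\<Union>F | F. finite F \<and> F \<subseteq> arithmetic_progressions}"

definition upper_buck_density :: "nat set \<Rightarrow> real" where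
  "upper_buck_density X =
     (INF C \<in> {C \<in> finite_unions_of_progressions. X \<subseteq> C}. upper_asymptotic_density C)"

end

theory Submission
  imports Defs
begin

text \<open>
  Every arithmetic upper quasi-density satisfies \<open>m X \<le> |X mod K| / K\<close>, and since \<open>B\<close> has Buck
  density zero, the sets \<open>B mod K\<close> have arbitrarily small relative size. Hence adding one residue
  class modulo \<open>K\<close> to a set \<open>P\<close> enlarges \<open>P + B\<close> by little, so a discrete intermediate value
  argument gives \<open>P\<close> and a class \<open>Q\<close> modulo \<open>K\<close> such that the density of \<open>P + B\<close> is at most \<open>\<alpha>\<close>
  and that of \<open>(P \<union> Q) + B\<close> is at least \<open>\<alpha>\<close>. Splitting \<open>Q\<close> into classes modulo a multiple of \<open>K\<close>
  and repeating yields nested bounds \<open>P\<^sub>n \<subseteq> A \<subseteq> P\<^sub>n \<union> Q\<^sub>n\<close> for \<open>A = \<Union>\<^sub>n P\<^sub>n\<close>, which squeeze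
  the densities of \<open>A\<close> and \<open>A + B\<close>.
\<close>

section \<open>Residues modulo \<open>K\<close> and shift-closed sets\<close>

definition residues_mod :: "nat \<Rightarrow> nat set \<Rightarrow> nat set" where
  "residues_mod K X = (\<lambda>x. x mod K) ` X"

text \<open>For \<open>K \<ge> 1\<close> this is the asymptotic density of the union of all classes
  modulo \<open>K\<close> that meet \<open>X\<close>, hence a periodic outer measure of the size of
  \<open>X\<close>.\<close>

definition residue_density :: "nat \<Rightarrow> nat set \<Rightarrow> real" where
  "residue_density K X = real (card (residues_mod K X)) / real K"

text \<open>For \<open>K \<ge> 1\<close> these are the finite unions of progressions with difference
  \<open>K\<close>, each with its own starting point. Full periodicity could be lost on passing to
  \<open>X + B\<close>; this property is not.\<close>

definition shift_closed :: "nat \<Rightarrow> nat set \<Rightarrow> bool" where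
  "shift_closed K X \<longleftrightarrow> (\<forall>x\<in>X. x + K \<in> X)"

lemma residues_mod_less: "K \<ge> 1 \<Longrightarrow> residues_mod K X \<subseteq> {..<K}"
  by (auto simp: residues_mod_def)

lemma finite_residues_mod: "K \<ge> 1 \<Longrightarrow> finite (residues_mod K X)"
  using finite_subset[OF residues_mod_less] by blast

lemma residue_density_mono:
  assumes "K \<ge> 1" "X \<subseteq> Y"
  shows "residue_density K X \<le> residue_density K Y"
proof -
  have "card (residues_mod K X) \<le> card (residues_mod K Y)"
    using assms by (intro card_mono finite_residues_mod) (auto simp: residues_mod_def)
  then show ?thesis by (simp add: residue_density_def divide_right_mono)
qed

lemma residue_density_Un:
  "residue_density K (X \<union> Y) \<le> residue_density K X + residue_density K Y"
proof -
  have "card (residues_mod K (X \<union> Y)) \<le> card (residues_mod K X) + card (residues_mod K Y)"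
    unfolding residues_mod_def image_Un by (rule card_Un_le)
  then have "real (card (residues_mod K (X \<union> Y)))
      \<le> real (card (residues_mod K X)) + real (card (residues_mod K Y))" by linarith
  then show ?thesis
    by (simp add: residue_density_def divide_right_mono flip: add_divide_distrib)
qed

lemma shift_closed_mult:
  assumes "shift_closed K X" "x \<in> X"
  shows "x + j * K \<in> X"
  using assms by (induction j) (auto simp: shift_closed_def algebra_simps)

lemma shift_closed_dvd:
  assumes "shift_closed K X" "K dvd L"
  shows "shift_closed L X"
  using assms shift_closed_mult[OF assms(1)] by (auto simp: shift_closed_def elim!: dvdE simp: mult.commute)

lemma shift_closed_Un: "shift_closed K X \<Longrightarrow> shift_closed K Y \<Longrightarrow> shift_closed K (X \<union> Y)"
  by (auto simp: shift_closed_def)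

lemma shift_closed_class: "shift_closed K {x. x mod K = q}"
  by (auto simp: shift_closed_def)

lemma shift_closed_plus:
  assumes "shift_closed K X"
  shows "shift_closed K (X + B)"
proof -
  have "x + b + K \<in> X + B" if "x \<in> X" "b \<in> B" for x b
  proof -
    have "x + K + b \<in> X + B"
      using assms that by (intro set_plus_intro) (auto simp: shift_closed_def)
    then show ?thesis by (simp add: add.commute add.left_commute)
  qed
  then show ?thesis by (auto simp: shift_closed_def elim!: set_plus_elim)
qed

text \<open>One representative in \<open>X\<close> is chosen for each residue met. Beyond the
  largest of these finitely many representatives, \<open>X\<close> contains every element of those
  classes.\<close>

lemma shift_closed_eventually:
  assumes "shift_closed K X" "K \<ge> 1"
  shows "\<exists>M. \<forall>y\<ge>M. y mod K \<in> residues_mod K X \<longrightarrow> y \<in> X"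
proof -
  have "\<forall>s\<in>residues_mod K X. \<exists>x. x \<in> X \<and> x mod K = s" by (auto simp: residues_mod_def)
  then obtain f where f: "\<And>s. s \<in> residues_mod K X \<Longrightarrow> f s \<in> X \<and> f s mod K = s" by metis
  obtain M where M: "\<And>s. s \<in> residues_mod K X \<Longrightarrow> f s \<le> M"
    using finite_imageI[OF finite_residues_mod[OF assms(2)], of f X] finite_nat_set_iff_bounded_le
    by (metis imageI)
  have "y \<in> X" if "y \<ge> M" "y mod K \<in> residues_mod K X" for y
  proof -
    let ?x = "f (y mod K)"
    have "?x \<le> y" "?x mod K = y mod K" using M f that by (auto intro: order_trans)
    then have "K dvd y - ?x" using mod_eq_dvd_iff_nat[of ?x y K] by simp
    then obtain j where "y - ?x = K * j" by (elim dvdE)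
    then have "y = ?x + j * K" using \<open>?x \<le> y\<close> by (simp add: mult.commute)
    then show "y \<in> X" using shift_closed_mult[OF assms(1), of ?x j] f[OF that(2)] by simp
  qed
  then show ?thesis by blast
qed

section \<open>Residue densities under a change of modulus\<close>

lemma card_mixed_radix:
  assumes "K \<ge> 1" "S \<subseteq> {..<K}"
  shows "card ((\<lambda>(i, s). (i + M) * K + s) ` ({..<n} \<times> S)) = n * card S"
proof -
  \<comment> \<open>Both \<open>i + M\<close> and \<open>s\<close> can be read off as quotient and
    remainder modulo \<open>K\<close>. The offset \<open>M\<close> is 0 for changes of modulus and
    positive in the asymptotic count.\<close>
  have "inj_on (\<lambda>(i, s). (i + M) * K + s) ({..<n} \<times> S)"
  proof (rule inj_onI, clarsimp)
    fix i s i' s' assume a: "s \<in> S" "s' \<in> S" "(i + M) * K + s = (i' + M) * K + s'"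
    then have "s < K" "s' < K" using assms by auto
    then have "((i + M) * K + s) div K = i + M" "((i' + M) * K + s') div K = i' + M"
      by auto
    then show "i = i' \<and> s = s'" using a by auto
  qed
  then show ?thesis by (simp add: card_image card_cartesian_product)
qed

text \<open>Each class modulo \<open>K\<close> splits into \<open>L\<close> classes modulo
  \<open>K * L\<close>, and \<open>X\<close> need not meet all of them.\<close>

lemma residue_density_mult_le:
  assumes "K \<ge> 1" "L \<ge> 1"
  shows "residue_density (K * L) X \<le> residue_density K X"
proof -
  let ?I = "(\<lambda>(i, s). (i + 0) * K + s) ` ({..<L} \<times> residues_mod K X)"
  have "residues_mod (K * L) X \<subseteq> ?I"
  proof
    fix y assume "y \<in> residues_mod (K * L) X"
    then obtain x where x: "x \<in> X" "y = x mod (K * L)" by (auto simp: residues_mod_def)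
    have "y mod K = x mod K" using x by (simp add: mod_mult2_eq)
    then have "y mod K \<in> residues_mod K X" using x(1) by (simp add: residues_mod_def)
    moreover have "y div K < L"
      using x assms by (simp add: less_mult_imp_div_less mult.commute)
    ultimately show "y \<in> ?I"
      by (intro image_eqI[of _ _ "(y div K, y mod K)"]) simp_all
  qed
  moreover have "finite ?I" using finite_residues_mod[OF assms(1)] by simp
  ultimately have "card (residues_mod (K * L) X) \<le> L * card (residues_mod K X)"
    using card_mixed_radix[OF assms(1) residues_mod_less[OF assms(1)], of 0 L X] card_mono by metis
  then have "real (card (residues_mod (K * L) X)) \<le> real L * real (card (residues_mod K X))"
    by (metis of_nat_le_iff of_nat_mult)
  then show ?thesis using assms by (simp add: residue_density_def field_simps)
qed

lemma residue_density_le_mult: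
  assumes "K \<ge> 1" "L \<ge> 1" "shift_closed K X"
  shows "residue_density K X \<le> residue_density (K * L) X"
proof -
  let ?I = "(\<lambda>(i, s). (i + 0) * K + s) ` ({..<L} \<times> residues_mod K X)"
  obtain M where M: "\<And>y. y \<ge> M \<Longrightarrow> y mod K \<in> residues_mod K X \<Longrightarrow> y \<in> X"
    using shift_closed_eventually assms by metis
  have "?I \<subseteq> residues_mod (K * L) X"
  proof clarsimp
    fix i s assume i: "i < L" and s: "s \<in> residues_mod K X"
    have sK: "s < K" using s residues_mod_less[OF assms(1)] by auto
    have "i * K + s < Suc i * K" using sK by simp
    also have "\<dots> \<le> K * L" using i by (metis Suc_leI mult.commute mult_le_mono2)
    finally have lt: "i * K + s < K * L" .
    \<comment> \<open>Adding a multiple of \<open>K * L\<close> keeps the residue and moves the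
      number past the threshold \<open>M\<close>, so a shift-closed set meets all \<open>L\<close>
      subclasses.\<close>
    let ?y = "i * K + s + K * L * M"
    have "?y mod K = s" using sK by (simp add: mult.assoc)
    moreover have "M \<le> ?y" using assms by (simp add: trans_le_add2)
    ultimately have "?y \<in> X" using M s by metis
    moreover have "?y mod (K * L) = i * K + s" using lt by simp
    ultimately show "i * K + s \<in> residues_mod (K * L) X"
      unfolding residues_mod_def by (metis imageI)
  qed
  then have "card ?I \<le> card (residues_mod (K * L) X)"
    using assms by (intro card_mono finite_residues_mod) auto
  then have "L * card (residues_mod K X) \<le> card (residues_mod (K * L) X)"
    using card_mixed_radix[OF assms(1) residues_mod_less[OF assms(1)], of 0 L X] by metis
  then have "real L * real (card (residues_mod K X)) \<le> real (card (residues_mod (K * L) X))"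
    by (metis of_nat_le_iff of_nat_mult)
  then show ?thesis using assms by (simp add: residue_density_def field_simps)
qed

text \<open>Modulo \<open>K\<close>, adding a single class only translates the residues of
  \<open>B\<close>. This bounds what one undecided class can contribute to the sumset.\<close>

lemma residue_density_class_plus:
  assumes "K \<ge> 1"
  shows "residue_density K ({x. x mod K = q} + B) \<le> residue_density K B"
proof -
  have "residues_mod K ({x. x mod K = q} + B) \<subseteq> (\<lambda>s. (q + s) mod K) ` residues_mod K B"
  proof
    fix r assume "r \<in> residues_mod K ({x. x mod K = q} + B)"
    then obtain x b where "x mod K = q" "b \<in> B" "r = (x + b) mod K"
      by (auto simp: residues_mod_def elim!: set_plus_elim)
    then have "r = (q + b mod K) mod K" "b mod K \<in> residues_mod K B"
      by (auto simp: residues_mod_def mod_simps)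
    then show "r \<in> (\<lambda>s. (q + s) mod K) ` residues_mod K B" by simp
  qed
  then have "card (residues_mod K ({x. x mod K = q} + B)) \<le> card (residues_mod K B)"
    by (meson assms card_image_le card_mono finite_imageI finite_residues_mod order_trans)
  then show ?thesis by (simp add: residue_density_def divide_right_mono)
qed

text \<open>A class counts at most \<open>1 / K\<close>, and a nonempty \<open>B\<close> meets at
  least one class. So smallness of \<open>B\<close> also controls the undecided part of
  \<open>A\<close> itself.\<close>

lemma residue_density_class_le:
  assumes "K \<ge> 1" "B \<noteq> {}"
  shows "residue_density K {x. x mod K = q} \<le> residue_density K B"
proof -
  have "residues_mod K {x. x mod K = q} \<subseteq> {q}" by (auto simp: residues_mod_def)
  then have "card (residues_mod K {x. x mod K = q}) \<le> 1" using card_mono[of "{q}"] by simp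
  moreover have "card (residues_mod K B) > 0"
    using assms finite_residues_mod[of K B] by (simp add: card_gt_0_iff residues_mod_def)
  ultimately have "card (residues_mod K {x. x mod K = q}) \<le> card (residues_mod K B)" by linarith
  then show ?thesis by (simp add: residue_density_def divide_right_mono)
qed

section \<open>Asymptotic and Buck density in terms of residues\<close>

lemma upper_asymptotic_density_ge:
  assumes "K \<ge> 1" "shift_closed K X"
  shows "residue_density K X \<le> upper_asymptotic_density X"
proof -
  define u where "u = (\<lambda>n. ereal (real (card (X \<inter> {1..n})) / real n))"
  let ?S = "residues_mod K X"
  obtain M0 where M0: "\<And>y. y \<ge> M0 \<Longrightarrow> y mod K \<in> ?S \<Longrightarrow> y \<in> X"
    using shift_closed_eventually assms by metis
  \<comment> \<open>The successor makes \<open>M\<close> positive, so the elements counted below lie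
    in an interval starting at 1 and no denominator vanishes.\<close>
  define M where "M = Suc M0"
  define r where "r = (\<lambda>n. (n + M) * K)"
  have M: "y \<in> X" if "y \<ge> M * K" "y mod K \<in> ?S" for y
  proof -
    have "M \<le> M * K" using assms by simp
    then show ?thesis using M0 that by (auto simp: M_def)
  qed
  \<comment> \<open>Past \<open>M * K\<close> the set contains all its residues in each block of
    length \<open>K\<close>, and \<open>n\<close> such blocks fit below \<open>r n\<close>. Along
    this subsequence the ratio is at least \<open>v n\<close>, which tends to the residue
    density.\<close>
  have count: "n * card ?S \<le> card (X \<inter> {1..r n})" for n
  proof -
    have "(\<lambda>(i, s). (i + M) * K + s) ` ({..<n} \<times> ?S) \<subseteq> X \<inter> {1..r n}"
    proof
      fix y assume "y \<in> (\<lambda>(i, s). (i + M) * K + s) ` ({..<n} \<times> ?S)"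
      then obtain i s where i: "i < n" and s: "s \<in> ?S" and y: "y = (i + M) * K + s" by auto
      have sK: "s < K" using s residues_mod_less[OF assms(1)] by auto
      have "(i + M) * K + s < Suc (i + M) * K" using sK by simp
      also have "\<dots> \<le> (n + M) * K" using i by (intro mult_le_mono1) simp
      finally have "(i + M) * K + s \<le> r n" by (simp add: r_def)
      moreover have "((i + M) * K + s) mod K = s" using sK by simp
      then have "(i + M) * K + s \<in> X" using s by (intro M) (simp_all add: add_mult_distrib)
      moreover have "1 \<le> (i + M) * K + s" using assms by (simp add: M_def)
      ultimately show "y \<in> X \<inter> {1..r n}" by (simp add: y)
    qed
    then have "card ((\<lambda>(i, s). (i + M) * K + s) ` ({..<n} \<times> ?S)) \<le> card (X \<inter> {1..r n})"
      by (intro card_mono) auto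
    then show ?thesis using card_mixed_radix[OF assms(1) residues_mod_less[OF assms(1)]] by metis
  qed
  define v where "v = (\<lambda>n. real n / real (n + M) * residue_density K X)"
  have "v \<longlonglongrightarrow> 1 * residue_density K X"
    unfolding v_def
  proof (intro tendsto_intros)
    have "(\<lambda>n. 1 - real M / real (n + M)) \<longlonglongrightarrow> 1 - 0"
      by (intro tendsto_intros LIMSEQ_ignore_initial_segment[OF lim_const_over_n])
    moreover have "real n / real (n + M) = 1 - real M / real (n + M)" for n
      by (simp add: M_def field_simps)
    ultimately show "(\<lambda>n. real n / real (n + M)) \<longlonglongrightarrow> 1" by simp
  qed
  then have "(\<lambda>n. ereal (v n)) \<longlonglongrightarrow> ereal (residue_density K X)" by simp
  then have "ereal (residue_density K X) = limsup (\<lambda>n. ereal (v n))"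
    using lim_imp_Limsup[OF sequentially_bot] by metis
  also have "\<dots> \<le> limsup (u \<circ> r)"
  proof (intro Limsup_mono always_eventually allI)
    fix n
    have "v n = real (n * card ?S) / real (r n)"
      by (simp add: v_def residue_density_def r_def)
    also have "\<dots> \<le> real (card (X \<inter> {1..r n})) / real (r n)"
      using count[of n] by (intro divide_right_mono) (auto simp flip: of_nat_mult)
    finally show "ereal (v n) \<le> (u \<circ> r) n" by (simp add: u_def)
  qed
  also have "\<dots> \<le> limsup u"
    using assms by (intro limsup_subseq_mono) (auto simp: strict_mono_def r_def)
  finally have lower: "ereal (residue_density K X) \<le> limsup u" .
  \<comment> \<open>This excludes the limit superior infinity, which \<open>real_of_ereal\<close>
    would send to 0.\<close>
  have "u n \<le> 1" for n
  proof -
    have "card (X \<inter> {1..n}) \<le> n" using card_mono[of "{1..n}" "X \<inter> {1..n}"] by simp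
    then show ?thesis by (cases n) (auto simp: u_def one_ereal_def)
  qed
  then have "limsup u \<le> 1" by (intro Limsup_bounded always_eventually) auto
  then show ?thesis
    using lower unfolding upper_asymptotic_density_def u_def[symmetric]
    by (cases "limsup u") auto
qed

text \<open>The product of the differences serves as a common modulus.\<close>

lemma finite_union_shift_closed:
  assumes "finite F" "F \<subseteq> arithmetic_progressions"
  shows "\<exists>K\<ge>1. shift_closed K (\<Union>F)"
  using assms
proof (induction F)
  case empty
  then show ?case by (auto simp: shift_closed_def)
next
  case (insert P F)
  obtain K where K: "K \<ge> 1" "shift_closed K (\<Union>F)" using insert by auto
  obtain k h where k: "k \<ge> 1" "P = range (\<lambda>x. k * x + h)"
    using insert.prems by (auto simp: arithmetic_progressions_def)
  have "k * x + h + k \<in> P" for x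
    unfolding k(2) by (rule range_eqI[of _ _ "Suc x"]) simp
  then have "shift_closed k P" unfolding shift_closed_def k(2) by auto
  then have "shift_closed (k * K) (\<Union>(insert P F))"
    using shift_closed_Un[OF shift_closed_dvd[of k P "k * K"] shift_closed_dvd[of K "\<Union>F" "k * K"]] K
    by simp
  moreover have "k * K \<ge> 1" using k K by simp
  ultimately show ?case by blast
qed

text \<open>A cover of \<open>B\<close> by finitely many progressions with small asymptotic density
  has equally small residue density for its common modulus, and \<open>B\<close> inherits the
  bound.\<close>

lemma upper_buck_density_zero_residue_density:
  assumes "upper_buck_density B = 0" "\<epsilon> > 0"
  shows "\<exists>K\<ge>1. residue_density K B < \<epsilon>"
proof -
  let ?D = "{C \<in> finite_unions_of_progressions. B \<subseteq> C}"
  \<comment> \<open>The full set of naturals is an admissible cover, so the infimum is over a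
    nonempty set.\<close>
  let ?U = "range (\<lambda>x. 1 * x + 0 :: nat)"
  have "?U \<in> arithmetic_progressions"
    unfolding arithmetic_progressions_def by blast
  then have "\<Union>{?U} \<in> finite_unions_of_progressions"
    unfolding finite_unions_of_progressions_def by blast
  moreover have "B \<subseteq> \<Union>{?U}" by simp
  ultimately have "?D \<noteq> {}" by blast
  moreover have "Inf (upper_asymptotic_density ` ?D) < \<epsilon>"
    using assms by (simp add: upper_buck_density_def)
  ultimately obtain C where C: "C \<in> finite_unions_of_progressions" "B \<subseteq> C"
      "upper_asymptotic_density C < \<epsilon>"
    using cInf_lessD[of "upper_asymptotic_density ` ?D" \<epsilon>] by blast
  obtain K where K: "K \<ge> 1" "shift_closed K C"
    using C(1) finite_union_shift_closed by (auto simp: finite_unions_of_progressions_def)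
  have "residue_density K B < \<epsilon>"
    using residue_density_mono[OF K(1) C(2)] upper_asymptotic_density_ge[OF K] C(3) by linarith
  then show ?thesis using K by blast
qed

section \<open>Bounds for an arbitrary arithmetic upper quasi-density\<close>

context
  fixes m :: "nat set \<Rightarrow> real"
  assumes m: "arithmetic_upper_quasi_density m"
begin

lemma quasi_density_Un: "m (X \<union> Y) \<le> m X + m Y"
  and quasi_density_le_1: "m X \<le> 1"
  and quasi_density_UNIV: "m UNIV = 1"
  and quasi_density_affine: "k \<ge> 1 \<Longrightarrow> m ((\<lambda>x. k * x + h) ` X) = 1 / real k * m X"
  using m unfolding arithmetic_upper_quasi_density_def by metis+

lemma quasi_density_empty: "m {} = 0"
  \<comment> \<open>Doubling fixes the empty set, so its value equals its own half.\<close>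
  using quasi_density_affine[of 2 0 "{}"] by simp

lemma quasi_density_UN:
  assumes "finite I"
  shows "m (\<Union>i\<in>I. f i) \<le> (\<Sum>i\<in>I. m (f i))"
  using assms
proof (induction I)
  case (insert i I)
  then show ?case using quasi_density_Un[of "f i" "\<Union>i\<in>I. f i"] by simp
qed (simp add: quasi_density_empty)

text \<open>The part of \<open>X\<close> in one class modulo \<open>K\<close> is an affine image
  with factor \<open>K\<close>, so its value is at most \<open>1 / K\<close>; subadditivity sums
  over the classes met. This replaces monotonicity.\<close>

lemma quasi_density_le_residue_density:
  assumes "K \<ge> 1"
  shows "m X \<le> residue_density K X"
proof -
  define f where "f h = (\<lambda>x. K * x + h) ` {x. K * x + h \<in> X}" for h
  have X: "X = (\<Union>h\<in>residues_mod K X. f h)"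
  proof (intro equalityI subsetI)
    fix x assume x: "x \<in> X"
    have "x \<in> f (x mod K)" unfolding f_def
      using x by (intro image_eqI[of _ _ "x div K"]) auto
    then show "x \<in> (\<Union>h\<in>residues_mod K X. f h)" using x by (auto simp: residues_mod_def)
  qed (auto simp: f_def)
  have "m (f h) \<le> 1 / real K" for h
    using quasi_density_affine[OF assms] quasi_density_le_1 by (simp add: f_def divide_right_mono)
  then have "(\<Sum>h\<in>residues_mod K X. m (f h)) \<le> real (card (residues_mod K X)) * (1 / real K)"
    by (intro sum_bounded_above) auto
  moreover have "m X \<le> (\<Sum>h\<in>residues_mod K X. m (f h))"
    using quasi_density_UN[OF finite_residues_mod[OF assms], of f X] X by simp
  ultimately show ?thesis by (simp add: residue_density_def)
qed

lemma quasi_density_finite: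
  assumes "finite X"
  shows "m X \<le> 0"
proof (rule tendsto_lowerbound[OF LIMSEQ_Suc[OF lim_const_over_n[of "real (card X)"]]])
  have "m X \<le> real (card X) / real (Suc n)" for n
  proof -
    have "card (residues_mod (Suc n) X) \<le> card X"
      unfolding residues_mod_def using assms by (rule card_image_le)
    then have "residue_density (Suc n) X \<le> real (card X) / real (Suc n)"
      unfolding residue_density_def by (intro divide_right_mono) auto
    then show ?thesis using quasi_density_le_residue_density[of "Suc n" X] by simp
  qed
  then show "\<forall>\<^sub>F n in sequentially. m X \<le> real (card X) / real (Suc n)" by simp
qed simp

text \<open>As \<open>m\<close> need not be monotone, the bound for \<open>- X\<close> is not inherited from the one for \<open>- Y\<close>.\<close>

lemma quasi_density_Compl_le:
  assumes "K \<ge> 1" "shift_closed K Y" "Y \<subseteq> X"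
  shows "m (- X) \<le> 1 - residue_density K Y"
proof -
  obtain M where M: "\<And>y. y \<ge> M \<Longrightarrow> y mod K \<in> residues_mod K Y \<Longrightarrow> y \<in> Y"
    using shift_closed_eventually assms by metis
  \<comment> \<open>Without its initial segment, \<open>- X\<close> avoids every class that
    \<open>Y\<close> meets; the removed segment is finite and contributes at most 0.\<close>
  let ?Z = "- X - {..<M}"
  have "residues_mod K ?Z \<subseteq> {..<K} - residues_mod K Y"
  proof
    fix r assume "r \<in> residues_mod K ?Z"
    then obtain x where x: "x \<notin> X" "x \<ge> M" "r = x mod K"
      unfolding residues_mod_def by (elim imageE) auto
    then have "r \<notin> residues_mod K Y" using M assms(3) by blast
    then show "r \<in> {..<K} - residues_mod K Y" using x assms(1) by simp
  qed
  then have "card (residues_mod K ?Z) \<le> card ({..<K} - residues_mod K Y)"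
    by (intro card_mono) auto
  also have "\<dots> = K - card (residues_mod K Y)"
    using card_Diff_subset finite_residues_mod residues_mod_less assms(1) by (metis card_lessThan)
  finally have "card (residues_mod K ?Z) \<le> K - card (residues_mod K Y)" .
  moreover have "card (residues_mod K Y) \<le> K"
    using card_mono[OF _ residues_mod_less[OF assms(1)]] by simp
  ultimately have "real (card (residues_mod K ?Z)) \<le> real K - real (card (residues_mod K Y))"
    by linarith
  then have "residue_density K ?Z \<le> 1 - residue_density K Y"
    using assms(1) by (simp add: residue_density_def field_simps)
  then have "m ?Z \<le> 1 - residue_density K Y"
    using quasi_density_le_residue_density[OF assms(1), of ?Z] by linarith
  moreover have "m (- X \<inter> {..<M}) \<le> 0" by (rule quasi_density_finite) simp
  moreover have "m (- X) \<le> m ?Z + m (- X \<inter> {..<M})"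
    using quasi_density_Un[of ?Z "- X \<inter> {..<M}"] by (simp add: Un_Diff_Int)
  ultimately show ?thesis by linarith
qed

text \<open>Membership in the domain of the induced density thus reduces to the reverse
  inequality.\<close>

lemma quasi_density_Compl_ge: "m X + m (- X) \<ge> 1"
  using quasi_density_Un[of X "- X"] quasi_density_UNIV by simp

end

section \<open>The nested stages\<close>

lemma discrete_crossing:
  fixes g :: "nat \<Rightarrow> real"
  assumes "g 0 \<le> \<alpha>" "\<alpha> \<le> g N" "N \<ge> 1"
  shows "\<exists>i<N. g i \<le> \<alpha> \<and> \<alpha> \<le> g (Suc i)"
  using assms(2,3)
proof (induction N)
  case (Suc N)
  show ?case
  proof (cases "g N \<le> \<alpha>")
    case False
    then have "N \<noteq> 0" using assms(1) by (metis)
    then obtain i where "i < N" "g i \<le> \<alpha>" "\<alpha> \<le> g (Suc i)" using Suc.IH False by auto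
    then show ?thesis using less_SucI by blast
  qed (use Suc in auto)
qed simp

text \<open>A stage of the construction: \<open>P\<close> is the part already chosen, and the residue class of \<open>q\<close>
  modulo \<open>K\<close> is the part still undecided.\<close>

definition stage :: "nat set \<Rightarrow> real \<Rightarrow> nat \<Rightarrow> nat \<times> nat set \<times> nat \<Rightarrow> bool" where
  "stage B \<alpha> n = (\<lambda>(K, P, q). K \<ge> 1 \<and> q < K \<and> shift_closed K P \<and>
     residue_density K B \<le> 1 / real (Suc n) \<and>
     residue_density K (P + B) \<le> \<alpha> \<and>
     \<alpha> \<le> residue_density K ((P \<union> {x. x mod K = q}) + B))"

text \<open>The range of candidates for \<open>A\<close>, from \<open>P\<close> up to
  \<open>P\<close> with its undecided class, shrinks from both sides.\<close>

definition refines :: "nat \<times> nat set \<times> nat \<Rightarrow> nat \<times> nat set \<times> nat \<Rightarrow> bool" where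
  "refines = (\<lambda>(K, P, q) (K', P', q').
     P \<subseteq> P' \<and> P' \<union> {x. x mod K' = q'} \<subseteq> P \<union> {x. x mod K = q})"

lemma stage_refine:
  assumes "upper_buck_density B = 0" "stage B \<alpha> n s"
  shows "\<exists>s'. stage B \<alpha> (Suc n) s' \<and> refines s s'"
proof -
  obtain K P q where s: "s = (K, P, q)" by (cases s)
  have K: "K \<ge> 1" "q < K" "shift_closed K P" "residue_density K (P + B) \<le> \<alpha>"
    "\<alpha> \<le> residue_density K ((P \<union> {x. x mod K = q}) + B)"
    using assms(2) by (auto simp: stage_def s)
  obtain L where L: "L \<ge> 1" "residue_density L B < 1 / real (Suc (Suc n))"
    using upper_buck_density_zero_residue_density[OF assms(1), of "1 / real (Suc (Suc n))"] by auto
  define K' where "K' = K * L"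
  have K': "K' \<ge> 1" using K L by (simp add: K'_def)
  \<comment> \<open>The undecided class modulo \<open>K\<close> is the union of the \<open>L\<close>
    classes of \<open>q + j * K\<close> modulo \<open>K * L\<close>. They are added to
    \<open>P\<close> one at a time; the one at which the sumset crosses \<open>\<alpha>\<close>
    becomes the new undecided class.\<close>
  define R where "R i = P \<union> {x. \<exists>j<i. x mod K' = q + j * K}" for i
  have R0: "R 0 = P" by (simp add: R_def)
  have RSuc: "R (Suc i) = R i \<union> {x. x mod K' = q + i * K}" for i
    by (auto simp: R_def less_Suc_eq)
  have RL: "R L = P \<union> {x. x mod K = q}"
  proof -
    have "(\<exists>j<L. x mod K' = q + j * K) \<longleftrightarrow> x mod K = q" for x
    proof
      assume "\<exists>j<L. x mod K' = q + j * K"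
      then obtain j where "x mod K' = q + j * K" by blast
      then have "x mod K' mod K = q" using K by simp
      then show "x mod K = q" by (simp add: K'_def mod_mult2_eq)
    next
      assume "x mod K = q"
      moreover have "x mod K' = x mod K + (x div K mod L) * K"
        by (simp add: K'_def mod_mult2_eq)
      moreover have "x div K mod L < L" using L by simp
      ultimately show "\<exists>j<L. x mod K' = q + j * K" by blast
    qed
    then show ?thesis by (simp add: R_def)
  qed
  have closed: "shift_closed K' (R i)" for i
    using shift_closed_dvd[OF K(3), of K'] by (auto simp: R_def shift_closed_def K'_def)
  define g where "g i = residue_density K' (R i + B)" for i
  \<comment> \<open>Refining the modulus cannot raise a residue density, and preserves it for
    shift-closed sets, so both bounds of the old stage survive at the ends \<open>R 0\<close> and
    \<open>R L\<close>.\<close>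
  have "g 0 \<le> \<alpha>"
    using residue_density_mult_le[OF K(1) L(1), of "P + B"] K(4) by (simp add: g_def R0 K'_def)
  moreover have "\<alpha> \<le> g L"
  proof -
    have "shift_closed K ((P \<union> {x. x mod K = q}) + B)"
      by (intro shift_closed_plus shift_closed_Un K shift_closed_class)
    then show ?thesis
      using residue_density_le_mult[OF K(1) L(1)] K(5) by (fastforce simp: g_def RL K'_def)
  qed
  ultimately obtain i where i: "i < L" "g i \<le> \<alpha>" "\<alpha> \<le> g (Suc i)"
    using discrete_crossing L(1) by blast
  have "residue_density K' B \<le> 1 / real (Suc (Suc n))"
    using residue_density_mult_le[OF L(1) K(1), of B] L(2) by (simp add: K'_def mult.commute)
  moreover have "q + i * K < K'"
  proof -
    have "q + i * K < Suc i * K" using K by simp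
    also have "\<dots> \<le> L * K" using i by (intro mult_le_mono1) simp
    finally show ?thesis by (simp add: K'_def mult.commute)
  qed
  ultimately have "stage B \<alpha> (Suc n) (K', R i, q + i * K)"
    using i K' closed by (simp add: stage_def g_def RSuc)
  moreover have "R (Suc i) \<subseteq> R L" using i(1) unfolding R_def by (auto dest: less_le_trans[OF _ Suc_leI])
  then have "R i \<union> {x. x mod K' = q + i * K} \<subseteq> P \<union> {x. x mod K = q}"
    by (simp only: RL RSuc)
  then have "refines s (K', R i, q + i * K)"
    by (auto simp: refines_def s R_def)
  ultimately show ?thesis by blast
qed

text \<open>Modulo 1 the undecided class is everything, and the two sumset densities are 0 and, as
  \<open>B\<close> is nonempty, 1.\<close>

lemma stage_initial:
  assumes "B \<noteq> {}" "\<alpha> \<in> {0..1}"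
  shows "stage B \<alpha> 0 (1, {}, 0)"
proof -
  have "residue_density 1 X = 1" if "X \<noteq> {}" for X
    using that by (simp add: residue_density_def residues_mod_def image_constant_conv)
  moreover have "UNIV + B \<noteq> {}" using assms by (auto simp: set_plus_def)
  moreover have "{} + B = {}" by (simp add: set_plus_def)
  ultimately show ?thesis
    using assms by (simp add: stage_def shift_closed_def residue_density_def residues_mod_def)
qed

section \<open>Passage to the limit\<close>

lemma le_of_le_add_inverse_Suc:
  fixes x y :: real
  assumes "\<And>n. x \<le> y + 1 / real (Suc n)"
  shows "x \<le> y"
proof (rule tendsto_lowerbound)
  show "(\<lambda>n. y + 1 / real (Suc n)) \<longlonglongrightarrow> y"
    using tendsto_add[OF tendsto_const LIMSEQ_inverse_real_of_nat, of y]
    by (simp add: inverse_eq_divide)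
  show "\<forall>\<^sub>F n in sequentially. x \<le> y + 1 / real (Suc n)" using assms by (intro always_eventually allI)
qed simp

theorem theorem2p3:
  fixes B :: "nat set" and \<alpha> :: real
  assumes "B \<noteq> {}"
    and "upper_buck_density B = 0"
    and "\<alpha> \<in> {0..1}"
  shows "\<exists>A :: nat set. \<forall>\<mu>. arithmetic_quasi_density \<mu> \<longrightarrow>
           A \<in> dom \<mu> \<and> A + B \<in> dom \<mu> \<and> \<mu> (A + B) = Some \<alpha>"
proof -
  obtain s where stage: "\<And>n. stage B \<alpha> n (s n)" and refines: "\<And>n. refines (s n) (s (Suc n))"
    using dependent_nat_choice[of "stage B \<alpha>" "\<lambda>_. refines"]
      stage_initial[OF assms(1,3)] stage_refine[OF assms(2)] by blast
  define K P q where "K n = fst (s n)" and "P n = fst (snd (s n))" and "q n = snd (snd (s n))" for n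
  define Q where "Q n = {x. x mod K n = q n}" for n
  have s: "s n = (K n, P n, q n)" for n by (simp add: K_def P_def q_def)
  have K: "K n \<ge> 1" and closed: "shift_closed (K n) (P n)"
    and dB: "residue_density (K n) B \<le> 1 / real (Suc n)"
    and lower: "residue_density (K n) (P n + B) \<le> \<alpha>"
    and upper: "\<alpha> \<le> residue_density (K n) ((P n \<union> Q n) + B)" for n
    using stage[of n] by (auto simp: stage_def s Q_def)
  have step: "P n \<subseteq> P (Suc n)" "P (Suc n) \<union> Q (Suc n) \<subseteq> P n \<union> Q n" for n
    using refines[of n] by (auto simp: refines_def s Q_def)
  define A where "A = (\<Union>n. P n)"
  have PA: "P n \<subseteq> A" for n by (auto simp: A_def)
  have AQ: "A \<subseteq> P n \<union> Q n" for n
  proof -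
    have "P k \<subseteq> P n \<union> Q n" for k
    proof (cases "n \<le> k")
      case True
      then show ?thesis
        using lift_Suc_antimono_le[of "\<lambda>n. P n \<union> Q n" n k] step(2) by blast
    next
      case False
      then show ?thesis
        using lift_Suc_mono_le[of P k n] step(1) by auto
    qed
    then show ?thesis by (auto simp: A_def)
  qed
  \<comment> \<open>The undecided class widens the sumset by at most the residue density of
    \<open>B\<close>, so the bounds around \<open>\<alpha>\<close> close up as \<open>n\<close>
    grows.\<close>
  have gap: "residue_density (K n) ((P n \<union> Q n) + B) \<le> residue_density (K n) (P n + B) + 1 / real (Suc n)"
    for n
  proof -
    have "(P n \<union> Q n) + B = (P n + B) \<union> (Q n + B)" by (auto simp: set_plus_def)
    then show ?thesis
      using residue_density_Un[of "K n" "P n + B" "Q n + B"] dB[of n]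
        residue_density_class_plus[OF K, of n "q n" B] by (simp add: Q_def)
  qed
  \<comment> \<open>\<open>A\<close> was built from \<open>B\<close> and \<open>\<alpha>\<close>
    alone, so a single set serves every \<open>m\<close>.\<close>
  have "A \<in> dom (induced_density m) \<and> A + B \<in> dom (induced_density m) \<and>
      induced_density m (A + B) = Some \<alpha>"
    if m: "arithmetic_upper_quasi_density m" for m
  proof -
    \<comment> \<open>\<open>m A\<close> is bounded through the outer set
      \<open>P n \<union> Q n\<close> and \<open>m (- A)\<close> through the inner set
      \<open>P n\<close>; the density of \<open>P n\<close> cancels in the sum.\<close>
    have "m A + m (- A) \<le> 1 + 1 / real (Suc n)" for n
      using quasi_density_le_residue_density[OF m K, of A n]
        residue_density_mono[OF K[of n] AQ[of n]] residue_density_Un[of "K n" "P n" "Q n"]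
        residue_density_class_le[OF K assms(1), of n "q n"] dB[of n]
        quasi_density_Compl_le[OF m K closed PA[of n]] by (simp add: Q_def)
    then have "m A + m (- A) = 1"
      using le_of_le_add_inverse_Suc quasi_density_Compl_ge[OF m] by (metis antisym)
    moreover have "m (A + B) \<le> \<alpha>"
    proof (rule le_of_le_add_inverse_Suc)
      fix n
      show "m (A + B) \<le> \<alpha> + 1 / real (Suc n)"
        using quasi_density_le_residue_density[OF m K, of "A + B" n]
          residue_density_mono[OF K[of n] set_plus_mono2[OF AQ[of n] order_refl[of B]]] gap[of n] lower[of n]
        by linarith
    qed
    \<comment> \<open>The inner sumset \<open>P n + B\<close> falls short of \<open>\<alpha>\<close>
      by at most the gap.\<close>
    moreover have "m (- (A + B)) \<le> 1 - \<alpha>"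
    proof (rule le_of_le_add_inverse_Suc)
      fix n
      show "m (- (A + B)) \<le> 1 - \<alpha> + 1 / real (Suc n)"
        using quasi_density_Compl_le[OF m K shift_closed_plus[OF closed]
              set_plus_mono2[OF PA[of n] order_refl[of B]]]
          gap[of n] upper[of n]
        by linarith
    qed
    \<comment> \<open>The two upper bounds add up to 1, while the sum of the values is at least 1,
      so both are equalities.\<close>
    ultimately show ?thesis
      using quasi_density_Compl_ge[OF m, of "A + B"]
      by (auto simp: induced_density_def conjugate_density_def dom_def Compl_eq_Diff_UNIV[symmetric])
  qed
  then show ?thesis by (auto simp: arithmetic_quasi_density_def)
qed

end
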